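(* There is a transitive homeomorphism on the Cantor fan; that is, if $X$ is a Cantor fan, then there exists a homeomorphism $f:X\to X$ such that for all non-empty open sets $U,V\subseteq X$ there is a non-negative integer $n$ with $f^n(U)\cap V\neq\emptyset$.
   Context: A continuum is a non-empty compact connected metric space. A continuum is a Cantor fan if it is homeomorphic to $\bigcup_{c\in C}A_c\subseteq\mathbb R^2$, where $C\subseteq[0,1]$ is a Cantor set and, for each $c\in C$, $A_c$ is the straight line segment in the plane from $(0,0)$ to $(c,-1)$. *)

theory Defs
  imports "HOL-Analysis.Analysis"
begin

primrec cantor_stage :: "nat \<Rightarrow> real set" where
  "cantor_stage 0 = {0..1}"
| "cantor_stage (Suc n) = (\<lambda>x. x / 3) ` cantor_stage n \<union> (\<lambda>x. (x + 2) / 3) ` cantor_stage n"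

text \<open>The middle-third set: stage \<open>Suc n\<close> consists of two copies of stage \<open>n\<close> scaled by 1/3,
  which is the same as deleting the open middle third of every interval of stage \<open>n\<close>.\<close>

definition ternary_cantor_set :: "real set" where
  "ternary_cantor_set = (\<Inter>n. cantor_stage n)"

definition cantor_set :: "real set \<Rightarrow> bool" where
  "cantor_set C \<longleftrightarrow> C homeomorphic ternary_cantor_set"

definition continuum :: "'a metric \<Rightarrow> bool" where
  "continuum X \<longleftrightarrow> mspace X \<noteq> {} \<and> compact_space (mtopology_of X) \<and> connected_space (mtopology_of X)"

text \<open>The metric of \<^typ>\<open>real \<times> real\<close> is the Euclidean one, so this type serves as the plane.\<close>

definition fan_over :: "real set \<Rightarrow> (real \<times> real) set" where
  "fan_over C = (\<Union>c\<in>C. closed_segment (0, 0) (c, -1))"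

definition cantor_fan :: "'a metric \<Rightarrow> bool" where
  "cantor_fan X \<longleftrightarrow> continuum X \<and>
     (\<exists>C \<subseteq> {0..1}. cantor_set C \<and> mtopology_of X homeomorphic_space top_of_set (fan_over C))"

text \<open>A self-map of the carrier of \<open>T\<close> is a total function on the type; only its values on
  \<^term>\<open>topspace T\<close> matter, since the iterates are applied to subsets of \<^term>\<open>topspace T\<close>.\<close>

definition transitive_map :: "'a topology \<Rightarrow> ('a \<Rightarrow> 'a) \<Rightarrow> bool" where
  "transitive_map T f \<longleftrightarrow>
     (\<forall>U V. openin T U \<and> U \<noteq> {} \<and> openin T V \<and> V \<noteq> {} \<longrightarrow> (\<exists>n. (f ^^ n) ` U \<inter> V \<noteq> {}))"

end

theory Submission
  imports Defs
begin

text \<open>The fan is the quotient of \<open>{0,1}\<^sup>\<int> \<times> [0, 1]\<close> by the collapse of the level 0. On this product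
  consider the skew product that shifts \<open>c\<close> and moves \<open>t\<close> by \<open>1\<close> or \<open>- \<theta>\<close> in the coordinate
  \<open>ln (t / (1 - t))\<close>, depending on the symbol \<open>c 0\<close>. It fixes the levels 0 and 1, so it descends to a
  homeomorphism of the fan. Between two prescribed central blocks one can insert \<open>a\<close> symbols 1 and
  \<open>b\<close> symbols 0, which changes the total displacement by \<open>a - b \<theta>\<close>; for irrational \<open>\<theta> > 0\<close>
  these numbers are dense in the line by Kronecker's theorem, and transitivity follows.\<close>

section \<open>The ternary expansion\<close>

definition ternary :: "(nat \<Rightarrow> bool) \<Rightarrow> real" where
  "ternary x = (\<Sum>n. 2 * of_bool (x n) / 3 ^ Suc n)"

lemma summable_ternary: "summable (\<lambda>n. 2 * of_bool (x n) / 3 ^ Suc n :: real)"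
proof (rule summable_comparison_test')
  show "summable (\<lambda>n. 2/3 * (1/3) ^ n :: real)"
    by (intro summable_mult summable_geometric) auto
qed (auto simp: power_one_over)

lemma ternary_rec: "ternary x = (2 * of_bool (x 0) + ternary (x \<circ> Suc)) / 3"
proof -
  have "ternary x = (\<Sum>n. 2 * of_bool (x (Suc n)) / 3 ^ Suc (Suc n)) + 2 * of_bool (x 0) / 3 ^ Suc 0"
    unfolding ternary_def using suminf_split_head[OF summable_ternary[of x]] by simp
  also have "(\<Sum>n. 2 * of_bool (x (Suc n)) / 3 ^ Suc (Suc n)) = ternary (x \<circ> Suc) / 3"
    unfolding ternary_def suminf_divide[OF summable_ternary, symmetric] by (simp add: mult.commute)
  finally show ?thesis by simp
qed

lemma ternary_bounds: "0 \<le> ternary x" "ternary x \<le> 1"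
proof -
  show "0 \<le> ternary x"
    unfolding ternary_def by (rule suminf_nonneg[OF summable_ternary]) auto
  have g: "(\<lambda>n. 2/3 * (1/3) ^ n :: real) sums (2/3 * (1 / (1 - 1/3)))"
    by (intro sums_mult geometric_sums) auto
  have "ternary x \<le> (\<Sum>n. 2/3 * (1/3) ^ n)"
    unfolding ternary_def
    by (rule suminf_le[OF _ summable_ternary sums_summable[OF g]]) (auto simp: power_one_over)
  also have "\<dots> = 1" using sums_unique[OF g] by simp
  finally show "ternary x \<le> 1" .
qed

text \<open>The first digit can be read off the value, which lies in [0, 1/3] for digit 0 and in
  [2/3, 1] for digit 1. Dropping that digit and repeating recovers all the others.\<close>

lemma inj_ternary: "inj ternary"
proof
  have head: "x 0 = y 0 \<and> ternary (x \<circ> Suc) = ternary (y \<circ> Suc)" if "ternary x = ternary y" for x y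
    using that ternary_rec[of x] ternary_rec[of y] ternary_bounds[of "x \<circ> Suc"]
      ternary_bounds[of "y \<circ> Suc"] by (cases "x 0"; cases "y 0") auto
  fix x y :: "nat \<Rightarrow> bool" assume "ternary x = ternary y"
  then have "x n = y n" for n
  proof (induction n arbitrary: x y)
    case (Suc n)
    then have "(x \<circ> Suc) n = (y \<circ> Suc) n" using head by blast
    then show ?case by simp
  qed (use head in blast)
  then show "x = y" by blast
qed

lemma ternary_in_cantor_stage: "ternary x \<in> cantor_stage n"
proof (induction n arbitrary: x)
  case (Suc n)
  then show ?case
    by (cases "x 0") (simp_all add: ternary_rec[of x] add.commute)
qed (auto simp: ternary_bounds)

lemma cantor_stage_subset: "cantor_stage n \<subseteq> {0..1}"
  by (induction n) auto

text \<open>The expanding map that undoes \<open>y / 3\<close> and \<open>(y + 2) / 3\<close>. The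
  cut at 1/2 lies in the removed middle third, so it separates the two copies.\<close>

definition ternary_shift :: "real \<Rightarrow> real" where
  "ternary_shift y = 3 * y - 2 * of_bool (1/2 < y)"

lemma ternary_shift_in_cantor:
  assumes "y \<in> ternary_cantor_set"
  shows "ternary_shift y \<in> ternary_cantor_set"
  unfolding ternary_cantor_set_def
proof (rule INT_I)
  fix n
  have "y \<in> cantor_stage (Suc n)"
    using assms unfolding ternary_cantor_set_def by blast
  then obtain z where "z \<in> cantor_stage n" "y = z / 3 \<or> y = (z + 2) / 3"
    by auto
  moreover have "0 \<le> z" "z \<le> 1"
    using cantor_stage_subset[of n] calculation by auto
  moreover from calculation have "ternary_shift y = z"
    by (auto simp: ternary_shift_def)
  ultimately show "ternary_shift y \<in> cantor_stage n" by simp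
qed

lemma range_ternary: "range ternary = ternary_cantor_set"
proof
  show "range ternary \<subseteq> ternary_cantor_set"
    using ternary_in_cantor_stage by (auto simp: ternary_cantor_set_def)
  \<comment> \<open>The itinerary of \<open>y\<close> serves as its digit sequence. Each step of
    \<open>ternary_shift\<close> triples the error \<open>y - ternary (x y)\<close>, and errors of
    points of the set are at most 1, so the error vanishes.\<close>
  define x where "x y n \<longleftrightarrow> 1/2 < (ternary_shift ^^ n) y" for y n
  have close: "\<bar>y - ternary (x y)\<bar> \<le> (1/3) ^ n" if "y \<in> ternary_cantor_set" for y n
    using that
  proof (induction n arbitrary: y)
    case 0
    then have "y \<in> cantor_stage 0" unfolding ternary_cantor_set_def by blast
    then show ?case using ternary_bounds[of "x y"] by auto
  next
    case (Suc n)
    have "x y \<circ> Suc = x (ternary_shift y)"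
      by (simp add: fun_eq_iff x_def funpow_Suc_right del: funpow.simps)
    then have "ternary (x y) = (2 * of_bool (1/2 < y) + ternary (x (ternary_shift y))) / 3"
      using ternary_rec[of "x y"] by (simp add: x_def)
    then have "y - ternary (x y) = (ternary_shift y - ternary (x (ternary_shift y))) / 3"
      by (simp add: ternary_shift_def field_simps)
    then have "\<bar>y - ternary (x y)\<bar> = \<bar>ternary_shift y - ternary (x (ternary_shift y))\<bar> / 3"
      by (simp only: abs_divide abs_numeral)
    then show ?case
      using Suc.IH[OF ternary_shift_in_cantor[OF Suc.prems]] by simp
  qed
  show "ternary_cantor_set \<subseteq> range ternary"
  proof
    fix y assume y: "y \<in> ternary_cantor_set"
    have "(\<lambda>n. (1/3) ^ n :: real) \<longlonglongrightarrow> 0"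
      by (rule LIMSEQ_realpow_zero) auto
    then have "\<bar>y - ternary (x y)\<bar> \<le> 0"
      by (rule LIMSEQ_le_const) (use close[OF y] in auto)
    then show "y \<in> range ternary" by auto
  qed
qed

lemma continuous_on_discrete_comp:
  fixes g :: "'b::discrete_topology \<Rightarrow> 'c::topological_space"
  assumes "continuous_on S f"
  shows "continuous_on S (\<lambda>x. g (f x))"
proof (rule continuous_on_compose2[OF _ assms])
  show "continuous_on UNIV g" by (simp add: continuous_on_open_vimage open_discrete)
qed auto

text \<open>The partial sums depend on finitely many discrete coordinates and converge uniformly by
  the Weierstrass test.\<close>

lemma continuous_ternary: "continuous_on UNIV ternary"
proof (rule uniform_limit_theorem[OF _ _ trivial_limit_sequentially])
  show "uniform_limit UNIV (\<lambda>n x. \<Sum>i<n. 2 * of_bool (x i) / 3 ^ Suc i) ternary sequentially"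
    unfolding ternary_def
  proof (rule Weierstrass_m_test)
    show "summable (\<lambda>n. 2/3 * (1/3) ^ n :: real)"
      by (intro summable_mult summable_geometric) auto
  qed (auto simp: power_one_over)
  show "\<forall>\<^sub>F n in sequentially. continuous_on UNIV (\<lambda>x. \<Sum>i<n. 2 * of_bool (x i) / 3 ^ Suc i :: real)"
    by (intro always_eventually allI continuous_on_sum continuous_on_divide continuous_on_mult
        continuous_on_const continuous_on_discrete_comp[where g = of_bool]) auto
qed

text \<open>Sequences are indexed by the integers so that the shift is invertible. A bijection
  between the integers and the naturals transports the ternary coding.\<close>

lemma cantor_set_eq_range_int_seq:
  assumes "cantor_set C"
  obtains e :: "(int \<Rightarrow> bool) \<Rightarrow> real"
  where "continuous_on UNIV e" "inj e" "range e = C"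
proof -
  obtain g g' where g: "homeomorphism ternary_cantor_set C g g'"
    using assms unfolding cantor_set_def by (meson homeomorphic_def homeomorphic_sym)
  define r :: "(int \<Rightarrow> bool) \<Rightarrow> nat \<Rightarrow> bool" where "r x = x \<circ> int_decode" for x
  have r: "bij r"
  proof (rule o_bij[where g = "\<lambda>y. y \<circ> int_encode"])
  qed (auto simp: r_def fun_eq_iff)
  have "continuous_on UNIV r"
    unfolding r_def comp_def by (intro continuous_intros) simp
  then have "continuous_on UNIV (ternary \<circ> r)"
    by (rule continuous_on_compose[OF _ continuous_on_subset[OF continuous_ternary]]) auto
  moreover have rg: "range (ternary \<circ> r) = ternary_cantor_set"
    using r range_ternary by (metis bij_def image_comp)
  ultimately have "continuous_on UNIV (g \<circ> (ternary \<circ> r))"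
    using g by (intro continuous_on_compose[of UNIV "ternary \<circ> r" g]) (auto simp: homeomorphism_def)
  moreover have "inj (g \<circ> (ternary \<circ> r))"
  proof (rule comp_inj_on)
    show "inj (ternary \<circ> r)" using r inj_ternary by (simp add: bij_def inj_compose)
    show "inj_on g (range (ternary \<circ> r))"
      using g unfolding rg homeomorphism_def by (metis inj_on_inverseI)
  qed
  moreover have "range (g \<circ> (ternary \<circ> r)) = C"
    using homeomorphism_image1[OF g] unfolding rg[symmetric] by (simp only: image_comp)
  ultimately show ?thesis using that by blast
qed

section \<open>Density of \<open>a - b \<theta>\<close>\<close>

lemma exists_pos_irrational: "\<exists>\<theta>::real. 0 < \<theta> \<and> \<theta> \<notin> \<rat>"
proof (rule ccontr)
  assume "\<not> ?thesis"
  then have "{0<..<1::real} \<subseteq> \<rat>" by auto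
  then show False
    using countable_rat countable_subset uncountable_open_interval[of 0 "1::real"] by auto
qed

lemma dense_nat_combinations:
  fixes \<theta> z \<epsilon> :: real
  assumes "0 < \<theta>" "\<theta> \<notin> \<rat>" "0 < \<epsilon>"
  obtains a b :: nat where "\<bar>real a - real b * \<theta> - z\<bar> < \<epsilon>"
proof -
  \<comment> \<open>Only multiples of \<open>M * \<theta>\<close> are used below; their size forces
    the integer \<open>a\<close> to be non-negative.\<close>
  obtain M :: nat where M: "\<bar>z\<bar> + 2 < real M * \<theta>"
    using \<open>0 < \<theta>\<close> reals_Archimedean3 by blast
  then have "M \<noteq> 0" by (cases M) auto
  have "real M * \<theta> \<notin> \<rat>"
  proof
    assume "real M * \<theta> \<in> \<rat>"
    then have "real M * \<theta> / real M \<in> \<rat>" by (intro Rats_divide) auto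
    with \<open>M \<noteq> 0\<close> assms show False by simp
  qed
  then obtain k where k: "k > 0" "\<bar>frac (real k * (real M * \<theta>)) - frac (-z)\<bar> < \<epsilon>"
    using Kronecker_approx_1_explicit[of "real M * \<theta>" "frac (-z)" \<epsilon>] assms
    by (metis frac_ge_0 frac_lt_1 less_imp_le)
  \<comment> \<open>With this choice the integer parts cancel, and the error is the difference of
    fractional parts bounded by Kronecker's theorem.\<close>
  define a where "a = \<lfloor>real k * (real M * \<theta>)\<rfloor> - \<lfloor>-z\<rfloor>"
  have "real M * \<theta> \<le> real k * (real M * \<theta>)"
    using k(1) M mult_right_mono[of 1 "real k" "real M * \<theta>"] by simp
  then have "0 \<le> a" using M unfolding a_def by linarith
  then have "real (nat a) - real (k * M) * \<theta> - z = - (frac (real k * (real M * \<theta>)) - frac (-z))"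
    by (simp add: a_def frac_def)
  with k(2) have "\<bar>real (nat a) - real (k * M) * \<theta> - z\<bar> < \<epsilon>" by simp
  then show ?thesis using that by blast
qed

section \<open>The skew product\<close>

text \<open>Translation by \<open>a\<close> in the coordinate \<open>ln (t / (1 - t))\<close> on \<open>(0, 1)\<close>, extended to the endpoints.\<close>

definition logit_shift :: "real \<Rightarrow> real \<Rightarrow> real" where
  "logit_shift a t = exp a * t / (1 - t + exp a * t)"

text \<open>The denominator is a convex combination of the positive numbers 1 and
  \<open>exp a\<close>.\<close>

lemma logit_shift_denom_pos:
  fixes a t :: real
  assumes "t \<in> {0..1}"
  shows "0 < 1 - t + exp a * t"
proof (cases "0 < t")
  case True
  then have "0 < exp a * t" by simp
  with assms show ?thesis by (simp add: add_nonneg_pos)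
next
  case False
  with assms have "t = 0" by simp
  then show ?thesis by simp
qed

lemma logit_shift_in:
  assumes "t \<in> {0..1}"
  shows "logit_shift a t \<in> {0..1}"
  using assms logit_shift_denom_pos[OF assms, of a] by (auto simp: logit_shift_def field_simps)

text \<open>The maps form a one-parameter group, so displacements along an orbit simply add
  up.\<close>

lemma logit_shift_add:
  assumes "t \<in> {0..1}"
  shows "logit_shift a (logit_shift b t) = logit_shift (a + b) t"
proof -
  define n d where "n = exp b * t" and "d = 1 - t + n"
  have d: "d > 0" using logit_shift_denom_pos[OF assms] by (simp add: n_def d_def)
  have l: "logit_shift b t = n / d" by (simp add: logit_shift_def n_def d_def)
  have "1 - n / d + exp a * (n / d) = (d - n + exp a * n) / d"
    using d by (simp add: diff_divide_distrib add_divide_distrib)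
  also have "d - n = 1 - t" by (simp add: d_def)
  finally have "1 - n / d + exp a * (n / d) = (1 - t + exp a * n) / d" .
  then have "logit_shift a (logit_shift b t) = exp a * n / (1 - t + exp a * n)"
    using d unfolding l by (simp add: logit_shift_def)
  then show ?thesis by (simp add: logit_shift_def n_def exp_add mult.assoc)
qed

lemma logit_shift_0 [simp]: "logit_shift 0 t = t"
  by (simp add: logit_shift_def)

lemma logit_shift_eq_0_iff:
  assumes "t \<in> {0..1}"
  shows "logit_shift a t = 0 \<longleftrightarrow> t = 0"
  using logit_shift_denom_pos[OF assms, of a] by (auto simp: logit_shift_def)

lemma logit_shift_transitive:
  assumes "s \<in> {0<..<1}" "r \<in> {0<..<1}"
  shows "\<exists>a. logit_shift a r = s"
proof -
  \<comment> \<open>The quotient of the odds of \<open>s\<close> and \<open>r\<close>; its logarithm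
    is the difference of their logit coordinates.\<close>
  define q where "q = s * (1 - r) / ((1 - s) * r)"
  have q: "q > 0" using assms by (simp add: q_def)
  have "q * r * (1 - s) = s * (1 - r)" using assms by (simp add: q_def)
  then have "q * r = s * (1 - r + q * r)" by (simp add: algebra_simps)
  moreover have "0 < 1 - r + q * r"
    using logit_shift_denom_pos[of r "ln q"] assms q by simp
  ultimately have "logit_shift (ln q) r = s"
    using q by (simp add: logit_shift_def divide_eq_eq)
  then show ?thesis by blast
qed

lemma continuous_on_logit_shift:
  assumes "continuous_on S f" "continuous_on S g" "\<And>x. x \<in> S \<Longrightarrow> g x \<in> {0..1}"
  shows "continuous_on S (\<lambda>x. logit_shift (f x) (g x))"
  unfolding logit_shift_def
  using logit_shift_denom_pos[OF assms(3)] assms(1,2)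
  by (intro continuous_intros) (auto simp: less_imp_neq[symmetric])

definition displacement :: "real \<Rightarrow> bool \<Rightarrow> real" where
  "displacement \<theta> b = (if b then 1 else - \<theta>)"

definition skew :: "real \<Rightarrow> (int \<Rightarrow> bool) \<times> real \<Rightarrow> (int \<Rightarrow> bool) \<times> real" where
  "skew \<theta> = (\<lambda>(c, t). (\<lambda>i. c (i + 1), logit_shift (displacement \<theta> (c 0)) t))"

text \<open>The symbol at -1 is read because the forward shift has just moved the symbol from 0 to
  -1.\<close>

definition skew_inv :: "real \<Rightarrow> (int \<Rightarrow> bool) \<times> real \<Rightarrow> (int \<Rightarrow> bool) \<times> real" where
  "skew_inv \<theta> = (\<lambda>(c, t). (\<lambda>i. c (i - 1), logit_shift (- displacement \<theta> (c (-1))) t))"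

abbreviation shift_cylinder :: "((int \<Rightarrow> bool) \<times> real) topology" where
  "shift_cylinder \<equiv> top_of_set (UNIV \<times> {0..1})"

lemma continuous_on_coord_fst:
  "continuous_on S (\<lambda>p :: ('i \<Rightarrow> 'b::topological_space) \<times> 'c::topological_space. fst p i)"
  by (rule continuous_on_product_then_coordinatewise) (intro continuous_intros)

lemma homeomorphic_maps_skew:
  "homeomorphic_maps shift_cylinder shift_cylinder (skew \<theta>) (skew_inv \<theta>)"
proof -
  let ?S = "UNIV \<times> {0..1} :: ((int \<Rightarrow> bool) \<times> real) set"
  have "continuous_on ?S (skew \<theta>)" "continuous_on ?S (skew_inv \<theta>)"
    unfolding skew_def skew_inv_def case_prod_beta
    by (intro continuous_on_Pair continuous_on_coordinatewise_then_product continuous_on_coord_fst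
        continuous_on_logit_shift continuous_on_discrete_comp[where g = "displacement \<theta>"]
        continuous_on_minus continuous_on_snd continuous_on_id; force)+
  moreover have "skew \<theta> \<in> ?S \<rightarrow> ?S" "skew_inv \<theta> \<in> ?S \<rightarrow> ?S"
    using logit_shift_in by (auto simp: skew_def skew_inv_def)
  moreover have "skew_inv \<theta> (skew \<theta> p) = p" "skew \<theta> (skew_inv \<theta> p) = p" if "p \<in> ?S" for p
    using that by (auto simp: skew_def skew_inv_def logit_shift_add)
  ultimately show ?thesis
    by (auto simp: homeomorphic_maps_def)
qed

lemma skew_funpow:
  assumes "t \<in> {0..1}"
  shows "(skew \<theta> ^^ n) (c, t) = (\<lambda>i. c (i + int n), logit_shift (\<Sum>k<n. displacement \<theta> (c (int k))) t)"
  using assms by (induction n) (auto simp: skew_def logit_shift_add add_ac)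

lemma open_fun_finite_agreement:
  fixes A :: "('i \<Rightarrow> 'b::topological_space) set"
  assumes "open A" "x \<in> A"
  obtains J where "finite J" "\<And>y. (\<And>i. i \<in> J \<Longrightarrow> y i = x i) \<Longrightarrow> y \<in> A"
proof -
  obtain X where X: "x \<in> (\<Pi>\<^sub>E i\<in>UNIV. X i)" "finite {i. X i \<noteq> UNIV}" "(\<Pi>\<^sub>E i\<in>UNIV. X i) \<subseteq> A"
    using product_topology_open_contains_basis[of "\<lambda>i. euclidean" UNIV A x] assms
    by (auto simp: open_fun_def)
  have "y \<in> A" if "\<And>i. i \<in> {i. X i \<noteq> UNIV} \<Longrightarrow> y i = x i" for y
  proof -
    have "y i \<in> X i" for i
      using that[of i] X(1) by (cases "X i = UNIV") (auto simp: PiE_iff)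
    then show ?thesis using X(3) by (auto simp: PiE_iff)
  qed
  with X(2) that show ?thesis by blast
qed

text \<open>Non-empty open sets contain boxes given by a symmetric window of symbols and a
  relatively open set of levels. The level \<open>s\<close> is taken in the open interval, where its
  logit coordinate is finite.\<close>

lemma openin_shift_cylinder_box:
  assumes "openin shift_cylinder U" "U \<noteq> {}"
  obtains s B m u where "s \<in> {0<..<1}" "open B" "s \<in> B"
    "\<forall>c t. (\<forall>i. \<bar>i\<bar> \<le> int m \<longrightarrow> c i = u i) \<and> t \<in> B \<inter> {0..1} \<longrightarrow> (c, t) \<in> U"
proof -
  obtain W where W: "open W" "U = (UNIV \<times> {0..1}) \<inter> W"
    using assms(1) by (auto simp: openin_open)
  then obtain u s0 where us: "(u, s0) \<in> W" "s0 \<in> {0..1}" using assms(2) by fast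
  obtain A B where AB: "open A" "open B" "u \<in> A" "s0 \<in> B" "A \<times> B \<subseteq> W"
    using open_prod_elim[OF W(1) us(1)] by (metis SigmaE2)
  \<comment> \<open>If the given level is an endpoint, density allows moving it inside without
    leaving \<open>B\<close>.\<close>
  have "s0 \<in> closure {0<..<1}" using us(2) by simp
  then obtain s where s: "s \<in> {0<..<1}" "s \<in> B"
    using AB(2,4) by (meson closure_iff_nhds_not_empty disjoint_iff order_refl)
  obtain J where J: "finite J" "\<And>c. (\<And>i. i \<in> J \<Longrightarrow> c i = u i) \<Longrightarrow> c \<in> A"
    using open_fun_finite_agreement[OF AB(1,3)] by blast
  obtain m where m: "\<And>i. i \<in> J \<Longrightarrow> nat \<bar>i\<bar> \<le> m"
    using finite_nat_set_iff_bounded_le[of "(\<lambda>i. nat \<bar>i\<bar>) ` J"] J(1) by auto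
  show ?thesis
  proof (rule that[OF s(1) AB(2) s(2)]; intro allI impI; elim conjE)
    fix c t assume c: "\<forall>i. \<bar>i\<bar> \<le> int m \<longrightarrow> c i = u i" and t: "t \<in> B \<inter> {0..1}"
    have "\<bar>i\<bar> \<le> int m" if "i \<in> J" for i using m[OF that] by linarith
    with c have "c \<in> A" by (intro J(2)) blast
    then show "(c, t) \<in> U" using t AB(5) W(2) by auto
  qed
qed

lemma sum_lessThan_add:
  fixes f :: "nat \<Rightarrow> 'a::comm_monoid_add"
  shows "(\<Sum>k<p + q. f k) = (\<Sum>k<p. f k) + (\<Sum>k<q. f (p + k))"
  by (induction q) (auto simp: add_ac)

text \<open>The orbit is built backwards from its end: the final level is exactly \<open>r\<close>,
  the initial level is determined by the total displacement, and the inserted symbols bring it into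
  \<open>B\<close>.\<close>

lemma transitive_skew:
  assumes "0 < \<theta>" "\<theta> \<notin> \<rat>"
  shows "transitive_map shift_cylinder (skew \<theta>)"
  unfolding transitive_map_def
proof (intro allI impI; elim conjE)
  fix U V assume UV: "openin shift_cylinder U" "U \<noteq> {}" "openin shift_cylinder V" "V \<noteq> {}"
  obtain s B m1 u where U: "s \<in> {0<..<1}" "open B" "s \<in> B"
    "\<forall>c t. (\<forall>i. \<bar>i\<bar> \<le> int m1 \<longrightarrow> c i = u i) \<and> t \<in> B \<inter> {0..1} \<longrightarrow> (c, t) \<in> U"
    by (rule openin_shift_cylinder_box[OF UV(1,2)])
  obtain r B' m2 v where V: "r \<in> {0<..<1}" "open B'" "r \<in> B'"
    "\<forall>c t. (\<forall>i. \<bar>i\<bar> \<le> int m2 \<longrightarrow> c i = v i) \<and> t \<in> B' \<inter> {0..1} \<longrightarrow> (c, t) \<in> V"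
    by (rule openin_shift_cylinder_box[OF UV(3,4)])
  have r: "r \<in> {0..1}" using V(1) by auto
  define m where "m = max m1 m2"
  obtain \<delta> where \<delta>: "logit_shift \<delta> r = s"
    using logit_shift_transitive U(1) V(1) by blast
  have "continuous_on UNIV (\<lambda>a. logit_shift a r)"
    by (intro continuous_on_logit_shift continuous_intros) (use r in auto)
  then have "open ((\<lambda>a. logit_shift a r) -` B)"
    using U(2) open_vimage by blast
  moreover have "\<delta> \<in> (\<lambda>a. logit_shift a r) -` B" using \<delta> U(3) by simp
  ultimately obtain \<epsilon> where \<epsilon>: "\<epsilon> > 0" "\<And>a. \<bar>a - \<delta>\<bar> < \<epsilon> \<Longrightarrow> logit_shift a r \<in> B"
    by (auto simp: open_dist dist_real_def)
  \<comment> \<open>The displacement due to the prescribed symbols met on the way: \<open>u\<close>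
    at 0 to \<open>m\<close>, and \<open>v\<close> at -\<open>m\<close> to -1.\<close>
  define K where "K = (\<Sum>k<m + 1. displacement \<theta> (u (int k))) + (\<Sum>k<m. displacement \<theta> (v (int k - int m)))"
  \<comment> \<open>The target makes the total displacement close to \<open>- \<delta>\<close>, so
    that undoing it carries \<open>r\<close> close to \<open>s\<close>.\<close>
  obtain a b where ab: "\<bar>real a - real b * \<theta> - (- \<delta> - K)\<bar> < \<epsilon>"
    using dense_nat_combinations[OF assms \<epsilon>(1)] by blast
  \<comment> \<open>After \<open>n\<close> steps position \<open>n\<close> sits at 0, so the window
    of \<open>v\<close> occupies \<open>n - m\<close> to \<open>n + m\<close> and begins right after
    the inserted symbols.\<close>
  define n where "n = (m + 1) + a + b + m"
  define c where "c k = (if k \<le> int m then u k else if k \<le> int (m + a) then True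
    else if k \<le> int (m + a + b) then False else v (k - int n))" for k
  define \<sigma> where "\<sigma> = (\<Sum>k<n. displacement \<theta> (c (int k)))"
  have "\<sigma> = K + real a - real b * \<theta>"
  proof -
    have "\<sigma> = (\<Sum>k<m + 1. displacement \<theta> (c (int k))) + (\<Sum>k<a. displacement \<theta> (c (int (m + 1 + k))))
        + (\<Sum>k<b. displacement \<theta> (c (int (m + 1 + a + k)))) + (\<Sum>k<m. displacement \<theta> (c (int (m + 1 + a + b + k))))"
      unfolding \<sigma>_def n_def sum_lessThan_add by (rule refl)
    also have "(\<Sum>k<m + 1. displacement \<theta> (c (int k))) = (\<Sum>k<m + 1. displacement \<theta> (u (int k)))"
      by (intro sum.cong) (auto simp: c_def)
    also have "(\<Sum>k<a. displacement \<theta> (c (int (m + 1 + k)))) = (\<Sum>k<a. 1)"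
      by (intro sum.cong) (auto simp: c_def displacement_def)
    also have "(\<Sum>k<b. displacement \<theta> (c (int (m + 1 + a + k)))) = (\<Sum>k<b. - \<theta>)"
      by (intro sum.cong) (auto simp: c_def displacement_def)
    also have "(\<Sum>k<m. displacement \<theta> (c (int (m + 1 + a + b + k)))) = (\<Sum>k<m. displacement \<theta> (v (int k - int m)))"
      by (intro sum.cong) (auto simp: c_def n_def algebra_simps)
    finally show ?thesis by (simp add: K_def)
  qed
  with ab have B: "logit_shift (- \<sigma>) r \<in> B" by (intro \<epsilon>(2)) linarith
  let ?p = "(c, logit_shift (- \<sigma>) r)"
  have "?p \<in> U"
    using B logit_shift_in[OF r] by (intro U(4)[rule_format]) (auto simp: c_def m_def)
  moreover have "(skew \<theta> ^^ n) ?p = (\<lambda>i. c (i + int n), r)"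
    using logit_shift_in[OF r] r by (simp add: skew_funpow logit_shift_add flip: \<sigma>_def)
  moreover have "(\<lambda>i. c (i + int n), r) \<in> V"
    using r V(3) by (intro V(4)[rule_format]) (auto simp: c_def n_def m_def)
  ultimately have "(skew \<theta> ^^ n) ?p \<in> (skew \<theta> ^^ n) ` U \<inter> V"
    by (metis IntI imageI)
  then show "\<exists>n. (skew \<theta> ^^ n) ` U \<inter> V \<noteq> {}" by (metis empty_iff)
qed

section \<open>Descent to the fan\<close>

text \<open>The universal property of the quotient gives both induced maps, and surjectivity of
  \<open>P\<close> carries over the inverse identities.\<close>

lemma homeomorphic_maps_descend:
  assumes P: "quotient_map Z X P" and FG: "homeomorphic_maps Z Z F G"
    and F: "\<And>y z. y \<in> topspace Z \<Longrightarrow> z \<in> topspace Z \<Longrightarrow> P y = P z \<Longrightarrow> P (F y) = P (F z)"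
    and G: "\<And>y z. y \<in> topspace Z \<Longrightarrow> z \<in> topspace Z \<Longrightarrow> P y = P z \<Longrightarrow> P (G y) = P (G z)"
  obtains f g where "homeomorphic_maps X X f g" "\<And>z. z \<in> topspace Z \<Longrightarrow> f (P z) = P (F z)"
proof -
  have cF: "continuous_map Z X (P \<circ> F)" and cG: "continuous_map Z X (P \<circ> G)"
    using FG quotient_imp_continuous_map[OF P] unfolding homeomorphic_maps_def
    by (blast intro: continuous_map_compose)+
  obtain f where f: "continuous_map X X f" "\<And>z. z \<in> topspace Z \<Longrightarrow> f (P z) = P (F z)"
    using quotient_map_lift_exists[OF P cF] F by (metis comp_apply)
  obtain g where g: "continuous_map X X g" "\<And>z. z \<in> topspace Z \<Longrightarrow> g (P z) = P (G z)"
    using quotient_map_lift_exists[OF P cG] G by (metis comp_apply)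
  have "F z \<in> topspace Z \<and> G z \<in> topspace Z \<and> G (F z) = z \<and> F (G z) = z" if "z \<in> topspace Z" for z
    using FG that unfolding homeomorphic_maps_def continuous_map_def by blast
  then have "g (f x) = x \<and> f (g x) = x" if "x \<in> topspace X" for x
    using that quotient_imp_surjective_map[OF P] f(2) g(2) by force
  with f(1) g(1) have "homeomorphic_maps X X f g" by (simp add: homeomorphic_maps_def)
  then show ?thesis using f(2) by (rule that)
qed

text \<open>Transitivity passes to factors: preimages of non-empty open sets are non-empty and open,
  and \<open>P\<close> maps a connecting orbit upstairs to one downstairs.\<close>

lemma transitive_map_semiconj:
  assumes P: "continuous_map Z X P" "P ` topspace Z = topspace X"
    and F: "F \<in> topspace Z \<rightarrow> topspace Z" "transitive_map Z F"
    and f: "\<And>z. z \<in> topspace Z \<Longrightarrow> f (P z) = P (F z)"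
  shows "transitive_map X f"
  unfolding transitive_map_def
proof (intro allI impI; elim conjE)
  fix U V assume U: "openin X U" "U \<noteq> {}" and V: "openin X V" "V \<noteq> {}"
  have pre: "openin Z {z \<in> topspace Z. P z \<in> W} \<and> {z \<in> topspace Z. P z \<in> W} \<noteq> {}"
    if W: "openin X W" "W \<noteq> {}" for W
  proof
    show "openin Z {z \<in> topspace Z. P z \<in> W}"
      using openin_continuous_map_preimage[OF P(1) W(1)] .
    obtain x where x: "x \<in> W" using W(2) by blast
    then have "x \<in> P ` topspace Z" using openin_subset[OF W(1)] P(2) by blast
    with x show "{z \<in> topspace Z. P z \<in> W} \<noteq> {}" by blast
  qed
  have "\<exists>n. (F ^^ n) ` {z \<in> topspace Z. P z \<in> U} \<inter> {z \<in> topspace Z. P z \<in> V} \<noteq> {}"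
    using F(2) pre[OF U] pre[OF V] unfolding transitive_map_def by simp
  then obtain n z where z: "z \<in> topspace Z" "P z \<in> U" "P ((F ^^ n) z) \<in> V"
    by blast
  have "(F ^^ k) z \<in> topspace Z \<and> (f ^^ k) (P z) = P ((F ^^ k) z)" for k
    using z(1) F(1) f by (induction k) auto
  then have "(f ^^ n) (P z) \<in> V" using z(3) by simp
  with z(2) have "(f ^^ n) (P z) \<in> (f ^^ n) ` U \<inter> V" by blast
  then show "\<exists>n. (f ^^ n) ` U \<inter> V \<noteq> {}" by (metis empty_iff)
qed

text \<open>Tychonoff's theorem for the sequence factor.\<close>

lemma compact_space_shift_cylinder: "compact_space shift_cylinder"
proof -
  have "compact_space (product_topology (\<lambda>_::int. euclidean :: bool topology) UNIV)"
    unfolding compact_space_product_topology by (simp add: compact_space_def finite_imp_compact)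
  then have "compact (UNIV :: (int \<Rightarrow> bool) set)"
    by (simp add: euclidean_product_topology compact_space_def)
  then show ?thesis
    by (simp add: compact_space_subtopology compact_Times)
qed

lemma cantor_fan_quotient:
  assumes "cantor_fan X"
  obtains P where "quotient_map shift_cylinder (mtopology_of X) P"
    "\<And>y z. y \<in> UNIV \<times> {0..1} \<Longrightarrow> z \<in> UNIV \<times> {0..1} \<Longrightarrow> P y = P z \<longleftrightarrow> y = z \<or> snd y = 0 \<and> snd z = 0"
proof -
  let ?S = "UNIV \<times> {0..1} :: ((int \<Rightarrow> bool) \<times> real) set"
  obtain C where C: "cantor_set C" "mtopology_of X homeomorphic_space top_of_set (fan_over C)"
    using assms unfolding cantor_fan_def by blast
  obtain e :: "(int \<Rightarrow> bool) \<Rightarrow> real" where e: "continuous_on UNIV e" "inj e" "range e = C"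
    using cantor_set_eq_range_int_seq[OF C(1)] .
  \<comment> \<open>The cone map: the point at level \<open>t\<close> on the segment from the origin
    to \<open>(e c, -1)\<close>. The second coordinate recovers \<open>t\<close>, and for nonzero
    \<open>t\<close> the first recovers \<open>c\<close>, so only level 0 is collapsed.\<close>
  define p where "p z = (snd z * e (fst z), - snd z)" for z
  have "continuous_on ?S p"
    unfolding p_def by (intro continuous_intros continuous_on_compose2[OF e(1)]) auto
  moreover have p_img: "p ` ?S = fan_over C"
  proof -
    have "closed_segment (0, 0) (c, -1) = (\<lambda>t. (t * c, - t)) ` {0..1::real}" for c :: real
      by (auto simp: closed_segment_def)
    then show ?thesis
      unfolding fan_over_def e(3)[symmetric] by (force simp: p_def)
  qed
  ultimately have cp: "continuous_map shift_cylinder (top_of_set (fan_over C)) p"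
    by auto
  have p_eq: "p y = p z \<longleftrightarrow> y = z \<or> snd y = 0 \<and> snd z = 0" for y z
    using e(2) by (auto simp: p_def prod_eq_iff inj_eq)
  obtain r where r: "homeomorphic_map (top_of_set (fan_over C)) (mtopology_of X) r"
    using C(2) homeomorphic_space homeomorphic_space_sym by blast
  have "quotient_map shift_cylinder (mtopology_of X) (r \<circ> p)"
  \<comment> \<open>A continuous surjection from a compact space onto a Hausdorff space is a
    quotient map.\<close>
  proof (rule T1_Spaces.continuous_imp_quotient_map)
    show "continuous_map shift_cylinder (mtopology_of X) (r \<circ> p)"
      using cp r homeomorphic_imp_continuous_map continuous_map_compose by blast
    show "(r \<circ> p) ` topspace shift_cylinder = topspace (mtopology_of X)"
      using p_img homeomorphic_imp_surjective_map[OF r] by (simp flip: image_image)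
    show "Hausdorff_space (mtopology_of X)"
      by (simp add: Metric_space.Hausdorff_space_mtopology mtopology_of_def)
  qed (rule compact_space_shift_cylinder)
  moreover have "(r \<circ> p) y = (r \<circ> p) z \<longleftrightarrow> y = z \<or> snd y = 0 \<and> snd z = 0" if "y \<in> ?S" "z \<in> ?S" for y z
  proof -
    have "p y \<in> fan_over C" "p z \<in> fan_over C" using that p_img by blast+
    then have "r (p y) = r (p z) \<longleftrightarrow> p y = p z"
      using homeomorphic_imp_injective_map[OF r] by (simp add: inj_on_eq_iff)
    then show ?thesis using p_eq by simp
  qed
  ultimately show ?thesis by (rule that)
qed

theorem theorem1p1:
  fixes X :: "'a metric"
  assumes "cantor_fan X"
  shows "\<exists>f. homeomorphic_map (mtopology_of X) (mtopology_of X) f \<and> transitive_map (mtopology_of X) f"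
proof -
  obtain \<theta> :: real where \<theta>: "0 < \<theta>" "\<theta> \<notin> \<rat>" using exists_pos_irrational by blast
  obtain P where P: "quotient_map shift_cylinder (mtopology_of X) P"
    and P_eq: "\<And>y z. y \<in> UNIV \<times> {0..1} \<Longrightarrow> z \<in> UNIV \<times> {0..1} \<Longrightarrow>
      P y = P z \<longleftrightarrow> y = z \<or> snd y = 0 \<and> snd z = 0"
    using cantor_fan_quotient[OF assms] by metis
  note FG = homeomorphic_maps_skew[of \<theta>]
  have F_in: "skew \<theta> \<in> UNIV \<times> {0..1} \<rightarrow> UNIV \<times> {0..1}" and G_in: "skew_inv \<theta> \<in> UNIV \<times> {0..1} \<rightarrow> UNIV \<times> {0..1}"
    using FG unfolding homeomorphic_maps_def continuous_map_def by auto
  \<comment> \<open>Level 0 is the only fibre of \<open>P\<close> with more than one point, so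
    preserving it in both directions is what the descent requires.\<close>
  have vertex: "snd (skew \<theta> z) = 0" "snd (skew_inv \<theta> z) = 0" if "snd z = 0" for z
    using that by (auto simp: skew_def skew_inv_def logit_shift_def split: prod.splits)
  have "P (skew \<theta> y) = P (skew \<theta> z)" "P (skew_inv \<theta> y) = P (skew_inv \<theta> z)"
    if "y \<in> topspace shift_cylinder" "z \<in> topspace shift_cylinder" "P y = P z" for y z
  proof -
    have yz: "y \<in> UNIV \<times> {0..1}" "z \<in> UNIV \<times> {0..1}" using that by auto
    with P_eq that(3) have "y = z \<or> snd y = 0 \<and> snd z = 0" by blast
    then show "P (skew \<theta> y) = P (skew \<theta> z)" "P (skew_inv \<theta> y) = P (skew_inv \<theta> z)"
      using P_eq vertex funcset_mem[OF F_in] funcset_mem[OF G_in] yz by metis+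
  qed
  then obtain f g where f: "homeomorphic_maps (mtopology_of X) (mtopology_of X) f g"
    "\<And>z. z \<in> topspace shift_cylinder \<Longrightarrow> f (P z) = P (skew \<theta> z)"
    using homeomorphic_maps_descend[OF P FG] by blast
  have "transitive_map (mtopology_of X) f"
    by (rule transitive_map_semiconj[OF quotient_imp_continuous_map[OF P]
          quotient_imp_surjective_map[OF P] _ transitive_skew[OF \<theta>] f(2)]) (use F_in in auto)
  with f(1) show ?thesis using homeomorphic_map_maps by blast
qed

end
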